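(* If $E(\lambda)$ is a skew-symmetric $n\times n$ matrix pencil with $\operatorname{rank}E=r\leq n$, then $r$ is even and $E(\lambda)$ can be written as $$E(\lambda)=v_1w_1^\top+\cdots+v_sw_s^\top-w_1v_1^\top-\cdots-w_sv_s^\top,$$ where $v_j,w_j\in\mathbb C[\lambda]^n$, $s=\frac r2$, $\deg v_1=\cdots=\deg v_s=0$, and $\deg w_1,\dots,\deg w_s\leq 1$.
   Context: A matrix pencil $E(\lambda)=A+\lambda B$ with $A,B\in\mathbb C^{n\times n}$ is skew-symmetric if $A^\top=-A$ and $B^\top=-B$. Its rank is the normal rank, i.e. the rank as a matrix over the field of rational functions, $\max_{\lambda\in\mathbb C}\operatorname{rank}(A+\lambda B)$. For $v(\lambda)\in\mathbb C[\lambda]^n$, $\deg v$ is the largest degree of the entries of $v$; so $\deg v=0$ means that $v$ is a constant vector in $\mathbb C^n$. *)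

theory Defs
  imports
    "HOL-Analysis.Analysis"
    "HOL-Computational_Algebra.Polynomial_Factorial"
begin

definition pencil :: "complex^'n^'m \<Rightarrow> complex^'n^'m \<Rightarrow> complex poly^'n^'m" where
  "pencil A B = (\<chi> i j. [:A $ i $ j, B $ i $ j:])"

definition skew_symmetric_pencil :: "complex^'n^'n \<Rightarrow> complex^'n^'n \<Rightarrow> bool" where
  "skew_symmetric_pencil A B \<longleftrightarrow> transpose A = - A \<and> transpose B = - B"

text \<open>Here \<^typ>\<open>complex poly fract\<close> is the field of rational functions over the complex numbers.\<close>

definition normal_rank :: "complex poly^'n^'m \<Rightarrow> nat" where
  "normal_rank E = rank (\<chi> i j. to_fract (E $ i $ j))"

text \<open>The zero vector gets degree \<open>0\<close>, since \<open>degree 0 = 0\<close>.\<close>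

definition vec_degree :: "complex poly^'n \<Rightarrow> nat" where
  "vec_degree v = Max (range (\<lambda>i. degree (v $ i)))"

text \<open>The matrix \<open>v w\<^sup>T\<close>.\<close>

definition outer_prod :: "complex poly^'m \<Rightarrow> complex poly^'n \<Rightarrow> complex poly^'n^'m" where
  "outer_prod v w = (\<chi> i j. v $ i * w $ j)"

end

theory Submission
  imports Defs "HOL-Computational_Algebra.Fundamental_Theorem_Algebra"
begin

text \<open>
  The pairs \<open>(v\<^sub>j, w\<^sub>j)\<close> are split off one at a time by skew-symmetric elimination, the
  analogue of completing a symplectic basis. Over a field, let \<open>M\<close> be skew-symmetric, \<open>b = M u\<close>,
  \<open>x\<^sup>T b = 1\<close> and \<open>c = M x\<close>. Then \<open>M + b c\<^sup>T - c b\<^sup>T\<close> is again skew-symmetric and has rank exactly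
  two less (\<open>rank_skew_update\<close>). Evenness of the rank and the number \<open>r/2\<close> of pairs follow by
  induction.

  Applied to a pencil \<open>E\<close> over the rational functions, such a step is useful only if \<open>b\<close> and \<open>x\<close> can
  be chosen constant: then \<open>c = E x\<close> has degree at most one, the updated matrix is again a pencil, and
  \<open>(b, - c)\<close> is a pair of the required degrees. If \<open>b\<close> is constant and nonzero, a constant \<open>x\<close> with
  \<open>x\<^sup>T b = 1\<close> exists, so it suffices that the column space of \<open>E\<close> contains a nonzero constant vector.

  This is where algebraic closedness enters (\<open>exists_const_image_direction\<close>). A constant vector \<open>u\<close>
  with \<open>B u = 0 \<noteq> A u\<close> satisfies \<open>E u = A u\<close>. If there is none, then \<open>ker B \<subseteq> ker A\<close>, and skew symmetry
  turns this into a factorisation \<open>A = B T\<close>. A suitable eigenvector \<open>z\<close> of \<open>T\<close> modulo \<open>ker B\<close> then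
  satisfies \<open>A z = \<mu> B z\<close> and \<open>B z \<noteq> 0\<close>, so that \<open>E z = (\<mu> + \<lambda>) B z\<close> is a nonzero polynomial
  times a constant vector.
\<close>

section \<open>Skew-symmetric elimination over a field\<close>

lemma transpose_eq_uminusI:
  assumes "\<And>i j. M $ i $ j = - M $ j $ i"
  shows "transpose M = - M"
  by (simp add: vec_eq_iff transpose_def) (use assms in blast)

lemma transpose_eq_uminusD:
  assumes "transpose M = - M"
  shows "M $ i $ j = - M $ j $ i"
  using arg_cong[OF assms, of "\<lambda>N. N $ j $ i"] by (simp add: transpose_def)

lemma scalar_product_commute:
  fixes x y :: "'a::comm_semiring_1^'n"
  shows "scalar_product x y = scalar_product y x"
  by (simp add: scalar_product_def mult.commute)

lemma scalar_product_skew: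
  fixes M :: "'a::comm_ring_1^'n^'n"
  assumes "transpose M = - M"
  shows "scalar_product x (M *v y) = - scalar_product (M *v x) y"
proof -
  have M: "M $ i $ j = - M $ j $ i" for i j
    by (rule transpose_eq_uminusD[OF assms])
  have "scalar_product x (M *v y) = (\<Sum>i\<in>UNIV. \<Sum>j\<in>UNIV. x $ i * (M $ i $ j * y $ j))"
    by (simp add: scalar_product_def matrix_vector_mult_def sum_distrib_left)
  also have "\<dots> = (\<Sum>j\<in>UNIV. \<Sum>i\<in>UNIV. x $ i * (M $ i $ j * y $ j))"
    by (rule sum.swap)
  also have "\<dots> = (\<Sum>j\<in>UNIV. \<Sum>i\<in>UNIV. - (M $ j $ i * x $ i * y $ j))"
    by (intro sum.cong refl) (subst M, simp add: algebra_simps)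
  also have "\<dots> = - scalar_product (M *v x) y"
    by (simp add: scalar_product_def matrix_vector_mult_def sum_distrib_right sum_negf)
  finally show ?thesis .
qed

lemma scalar_product_skew_self:
  fixes M :: "'a::idom^'n^'n"
  assumes "transpose M = - M" "(2::'a) \<noteq> 0"
  shows "scalar_product x (M *v x) = 0"
proof -
  have "scalar_product x (M *v x) = - scalar_product x (M *v x)"
    using scalar_product_skew[OF assms(1), of x x] by (simp add: scalar_product_commute)
  hence "2 * scalar_product x (M *v x) = 0"
    by (metis add.left_inverse mult_2)
  thus ?thesis using assms(2) by simp
qed

definition skew_update :: "'a::comm_ring_1^'n^'n \<Rightarrow> 'a^'n \<Rightarrow> 'a^'n \<Rightarrow> 'a^'n^'n" where
  "skew_update M b c = (\<chi> i j. M $ i $ j + b $ i * c $ j - c $ i * b $ j)"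

lemma transpose_skew_update:
  assumes "transpose M = - M"
  shows "transpose (skew_update M b c) = - skew_update M b c"
proof (rule transpose_eq_uminusI)
  fix i j
  have "M $ i $ j = - M $ j $ i" by (rule transpose_eq_uminusD[OF assms])
  thus "skew_update M b c $ i $ j = - skew_update M b c $ j $ i"
    by (simp add: skew_update_def algebra_simps)
qed

lemma skew_update_mult_vec:
  "skew_update M b c *v y = M *v y + scalar_product c y *s b - scalar_product b y *s c"
  by (simp add: vec_eq_iff matrix_vector_mult_def skew_update_def scalar_product_def
      sum.distrib sum_subtractf sum_distrib_right sum_distrib_left algebra_simps)

lemma scalar_product_span_eq_0:
  fixes z :: "'a::field^'n"
  assumes "y \<in> vec.span S" "\<And>s. s \<in> S \<Longrightarrow> scalar_product z s = 0"
  shows "scalar_product z y = 0"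
  using assms(1)
proof (induction rule: vec.span_induct_alt)
  case base
  show ?case by (simp add: scalar_product_def)
next
  case (step k s y)
  have "scalar_product z (k *s s + y) = k * scalar_product z s + scalar_product z y"
    by (simp add: scalar_product_def sum.distrib sum_distrib_left algebra_simps)
  with step assms(2) show ?case by simp
qed

text \<open>The vectors \<open>u\<close> and \<open>x\<close> span a hyperbolic plane for the form \<open>M\<close>, and the update is chosen so that
  both lie in the kernel of the new matrix \<open>N\<close>. The rows of \<open>N\<close> are therefore orthogonal to \<open>u\<close> and \<open>x\<close>,
  whereas \<open>x\<close> detects \<open>b\<close>, and \<open>u\<close> detects \<open>c\<close> but not \<open>b\<close>. Hence \<open>b\<close> and \<open>c\<close> add two independent
  directions to the row space of \<open>N\<close>, and the sum is the row space of \<open>M\<close>, which contains \<open>b\<close> and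
  \<open>c\<close> because the rows of a skew-symmetric matrix are its negated columns.\<close>

lemma rank_skew_update:
  fixes M :: "'a::field^'n^'n"
  assumes skew: "transpose M = - M" and two: "(2::'a) \<noteq> 0"
    and xMu: "scalar_product x (M *v u) = 1"
  defines "b \<equiv> M *v u" and "c \<equiv> M *v x"
  shows "rank M = rank (skew_update M b c) + 2"
proof -
  let ?N = "skew_update M b c"
  note skewN = transpose_skew_update[OF skew, of b c]
  have M: "M $ i $ j = - M $ j $ i" for i j
    by (rule transpose_eq_uminusD[OF skew])
  have xb: "scalar_product x b = 1" and uc: "scalar_product u c = -1"
    using xMu scalar_product_skew[OF skew, of u x]
    by (simp_all add: b_def c_def scalar_product_commute)
  have ub: "scalar_product u b = 0" and xc: "scalar_product x c = 0"
    by (simp_all add: b_def c_def scalar_product_skew_self[OF skew two])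
  have Nu: "?N *v u = 0" and Nx: "?N *v x = 0"
    using xb uc ub xc
    by (simp_all add: skew_update_mult_vec scalar_product_commute[of c] scalar_product_commute[of b]
        b_def[symmetric] c_def[symmetric] vec_eq_iff)
  have row_orth: "scalar_product z s = 0" if z: "?N *v z = 0" and s: "s \<in> rows ?N" for z s
  proof -
    obtain i where "s = row i ?N" using s by (auto simp: rows_def)
    hence "scalar_product z s = (?N *v z) $ i"
      by (simp add: scalar_product_def matrix_vector_mult_def row_def mult.commute)
    thus ?thesis using z by simp
  qed
  have b_new: "b \<notin> vec.span (rows ?N)"
    using scalar_product_span_eq_0[OF _ row_orth[OF Nx]] xb by fastforce
  have c_new: "c \<notin> vec.span (insert b (rows ?N))"
  proof
    assume "c \<in> vec.span (insert b (rows ?N))"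
    hence "scalar_product u c = 0"
      by (rule scalar_product_span_eq_0) (use ub row_orth[OF Nu] in auto)
    with uc show False by simp
  qed
  have range_M: "M *v y \<in> vec.span (rows M)" for y
  proof -
    have "M *v y = (\<Sum>j\<in>UNIV. (- y $ j) *s row j M)"
      by (simp add: vec_eq_iff matrix_vector_mult_def row_def)
        (subst M, simp add: sum_negf mult.commute)
    also have "\<dots> \<in> vec.span (rows M)"
      by (intro vec.span_sum vec.span_scale vec.span_base) (auto simp: rows_def)
    finally show ?thesis .
  qed
  have row_N: "row i ?N = row i M + b $ i *s c - c $ i *s b" for i
    by (simp add: vec_eq_iff row_def skew_update_def)
  have "vec.span (rows M) = vec.span (insert c (insert b (rows ?N)))" (is "_ = vec.span ?S")
  proof (rule vec.span_eq[THEN iffD2], intro conjI subsetI)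
    fix s assume "s \<in> rows M"
    then obtain i where "s = row i M" by (auto simp: rows_def)
    hence s: "s = row i ?N - b $ i *s c + c $ i *s b"
      by (simp add: row_N)
    have "row i ?N \<in> ?S" by (auto simp: rows_def)
    thus "s \<in> vec.span ?S"
      unfolding s by (intro vec.span_add vec.span_diff vec.span_scale vec.span_base) auto
  next
    fix s assume "s \<in> ?S"
    moreover have bc: "b \<in> vec.span (rows M)" "c \<in> vec.span (rows M)"
      using range_M by (simp_all only: b_def c_def)
    moreover have "row i ?N \<in> vec.span (rows M)" for i
      unfolding row_N
      by (intro vec.span_add vec.span_diff vec.span_scale bc vec.span_base) (auto simp: rows_def)
    hence "rows ?N \<subseteq> vec.span (rows M)" by (auto simp: rows_def[of ?N])
    ultimately show "s \<in> vec.span (rows M)" by auto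
  qed
  hence "vec.dim (rows M) = vec.dim ?S"
    by (metis vec.dim_span)
  also have "\<dots> = vec.dim (rows ?N) + 2"
    using b_new c_new by (simp add: vec.dim_insert)
  finally show ?thesis by (simp add: row_rank_def_gen)
qed

section \<open>Constant vectors in the column space of a skew-symmetric pencil\<close>

definition poly_apply :: "'a::field poly \<Rightarrow> 'a^'n^'n \<Rightarrow> 'a^'n \<Rightarrow> 'a^'n" where
  "poly_apply p T y = (\<Sum>i\<le>degree p. coeff p i *s ((*v) T ^^ i) y)"

lemma poly_apply_altdef:
  assumes "degree p \<le> n"
  shows "poly_apply p T y = (\<Sum>i\<le>n. coeff p i *s ((*v) T ^^ i) y)"
  unfolding poly_apply_def
  by (rule sum.mono_neutral_left) (use assms in \<open>auto simp: coeff_eq_0\<close>)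

lemma funpow_mult_vec_diff:
  fixes T :: "'a::field^'n^'n"
  shows "((*v) T ^^ i) (y - k *s z) = ((*v) T ^^ i) y - k *s ((*v) T ^^ i) z"
  by (induction i) (simp_all add: matrix_vector_mult_diff_distrib vector_scalar_commute)

text \<open>The rule \<open>((T - \<mu>) q(T)) y = q(T) ((T - \<mu>) y)\<close>, which lets the root factors of a polynomial that
  annihilates a vector be applied to that vector one by one.\<close>

lemma poly_apply_linear_factor:
  "poly_apply ([:- \<mu>, 1:] * q) T y = poly_apply q T (T *v y - \<mu> *s y)"
proof -
  let ?n = "Suc (degree q)" and ?f = "\<lambda>i. ((*v) T ^^ i) y"
  have deg: "degree ([:- \<mu>, 1:] * q) \<le> ?n"
    by (rule order.trans[OF degree_mult_le]) simp
  have coeff: "coeff ([:- \<mu>, 1:] * q) i = (case i of 0 \<Rightarrow> 0 | Suc k \<Rightarrow> coeff q k) - \<mu> * coeff q i" for i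
    by (simp add: coeff_pCons split: nat.split)
  have "poly_apply ([:- \<mu>, 1:] * q) T y =
      (\<Sum>i\<le>?n. (case i of 0 \<Rightarrow> 0 | Suc k \<Rightarrow> coeff q k) *s ?f i) - (\<Sum>i\<le>?n. (\<mu> * coeff q i) *s ?f i)"
    unfolding poly_apply_altdef[OF deg] coeff by (simp only: vec.scale_left_diff_distrib sum_subtractf)
  also have "(\<Sum>i\<le>?n. (case i of 0 \<Rightarrow> 0 | Suc k \<Rightarrow> coeff q k) *s ?f i) =
      (\<Sum>i\<le>degree q. coeff q i *s ?f (Suc i))"
    by (subst sum.atMost_Suc_shift) simp
  also have "(\<Sum>i\<le>?n. (\<mu> * coeff q i) *s ?f i) = (\<Sum>i\<le>degree q. (\<mu> * coeff q i) *s ?f i)"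
    by (simp add: coeff_eq_0)
  finally show ?thesis
    by (simp add: poly_apply_def funpow_mult_vec_diff funpow_swap1 vec.scale_right_diff_distrib
        sum_subtractf mult.commute)
qed

text \<open>The \<open>n + 1\<close> iterates \<open>y, T y, \<dots>, T\<^sup>n y\<close> in an \<open>n\<close>-dimensional space are linearly dependent as a
  family; this is either a repetition among them or a dependence of the set they form.\<close>

lemma exists_annihilating_poly:
  fixes T :: "'a::field^'n^'n"
  shows "\<exists>p. p \<noteq> 0 \<and> poly_apply p T y = 0"
proof -
  let ?f = "\<lambda>i. ((*v) T ^^ i) y" and ?n = "CARD('n)"
  have witness: ?thesis if c: "(\<Sum>i\<le>?n. c i *s ?f i) = 0" "k \<le> ?n" "c k \<noteq> 0" for c k
  proof -
    define p where "p = (\<Sum>i\<le>?n. monom (c i) i)"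
    have coeff: "coeff p i = (if i \<le> ?n then c i else 0)" for i
      by (simp add: p_def coeff_sum)
    have "degree p \<le> ?n" by (rule degree_le) (simp add: coeff)
    hence "poly_apply p T y = 0" using c(1) by (simp add: poly_apply_altdef coeff)
    moreover have "p \<noteq> 0" using c(2,3) coeff[of k] by auto
    ultimately show ?thesis by blast
  qed
  show ?thesis
  proof (cases "inj_on ?f {..?n}")
    case True
    have "vec.dependent (?f ` {..?n})"
      using dim_subset_UNIV_cart_gen[of "?f ` {..?n}"]
      by (intro vec.dependent_biggerset_general) (simp add: card_image[OF True])
    then obtain g v where g: "v \<in> ?f ` {..?n}" "g v \<noteq> 0" "(\<Sum>v\<in>?f ` {..?n}. g v *s v) = 0"
      by (auto simp: vec.dependent_finite)
    have "(\<Sum>i\<le>?n. g (?f i) *s ?f i) = 0"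
      using g(3) by (simp add: sum.reindex[OF True])
    with g show ?thesis using witness[of "\<lambda>i. g (?f i)"] by auto
  next
    case False
    then obtain i j where ij: "i \<le> ?n" "j \<le> ?n" "i \<noteq> j" "?f i = ?f j"
      by (auto simp: inj_on_def)
    let ?c = "\<lambda>k. (if k = i then 1 else 0) - (if k = j then 1 else 0)"
    have "(\<Sum>k\<le>?n. ?c k *s ?f k) = 0"
      using ij by (simp add: vec.scale_left_diff_distrib sum_subtractf if_distrib[of "\<lambda>a. a *s _"]
          sum.delta cong: if_cong)
    with ij show ?thesis using witness[of ?c i] by auto
  qed
qed

text \<open>An eigenvector of \<open>T\<close> modulo \<open>ker B\<close>, although \<open>ker B\<close> need not be invariant under \<open>T\<close>. A product
  of factors \<open>T - \<mu>\<^sub>i\<close> takes \<open>y\<close> to \<open>0\<close>; since \<open>y\<close> lies outside \<open>ker B\<close> and \<open>0\<close> inside,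
  one of the factors takes some vector \<open>z\<close> from outside \<open>ker B\<close> into it.\<close>

lemma exists_relative_eigenvector:
  fixes B T :: "complex^'n^'n"
  assumes "B *v y \<noteq> 0"
  shows "\<exists>z \<mu>. B *v z \<noteq> 0 \<and> B *v (T *v z) = \<mu> *s (B *v z)"
proof -
  have "\<exists>z \<mu>. B *v z \<noteq> 0 \<and> B *v (T *v z) = \<mu> *s (B *v z)"
    if "degree p = n" "p \<noteq> 0" "poly_apply p T y = 0" "B *v y \<noteq> 0" for n p y
    using that
  proof (induction n arbitrary: p y)
    case 0
    then obtain a where "p = [:a:]" by (auto elim: degree_eq_zeroE)
    with 0 show ?case by (auto simp: poly_apply_def)
  next
    case (Suc n)
    have "\<not> constant (poly p)" using Suc.prems by (simp add: constant_degree)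
    then obtain \<mu> where "poly p \<mu> = 0"
      using fundamental_theorem_of_algebra by blast
    then obtain q where q: "p = [:- \<mu>, 1:] * q" unfolding poly_eq_0_iff_dvd by (elim dvdE)
    have "q \<noteq> 0" using Suc.prems(2) q by auto
    have "degree p = Suc (degree q)"
      unfolding q by (subst degree_mult_eq) (use \<open>q \<noteq> 0\<close> in auto)
    with Suc.prems(1) have "degree q = n" by simp
    let ?z = "T *v y - \<mu> *s y"
    have z: "poly_apply q T ?z = 0"
      using Suc.prems(3) by (simp only: q poly_apply_linear_factor)
    show ?case
    proof (cases "B *v ?z = 0")
      case True
      hence "B *v (T *v y) = \<mu> *s (B *v y)"
        by (simp add: matrix_vector_mult_diff_distrib vector_scalar_commute)
      with Suc.prems(4) show ?thesis by blast
    next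
      case False
      show ?thesis by (rule Suc.IH[OF \<open>degree q = n\<close> \<open>q \<noteq> 0\<close> z False])
    qed
  qed
  with exists_annihilating_poly[of T y] assms show ?thesis by blast
qed

text \<open>Inclusion of kernels gives a factorisation \<open>A = S B\<close> on the other side; for skew-symmetric
  matrices, transposing it yields \<open>A = B S\<^sup>T\<close>.\<close>

lemma skew_factor_through:
  fixes A B :: "'a::field^'n^'n"
  assumes "transpose A = - A" "transpose B = - B"
    and ker: "\<And>z. B *v z = 0 \<Longrightarrow> A *v z = 0"
  shows "\<exists>T. A = B ** T"
proof -
  obtain g where g: "Vector_Spaces.linear (*s) (*s) g" "\<And>v. B *v g (B *v v) = B *v v"
    using vec.linear_exists_right_inverse_on[OF matrix_vector_mul_linear_gen[of B] vec.subspace_UNIV]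
    by auto
  let ?G = "matrix g"
  \<comment> \<open>\<open>g\<close> is a generalised inverse of \<open>B\<close>, so \<open>v\<close> and \<open>g (B v)\<close> differ by an element of \<open>ker B\<close>.\<close>
  have "A *v v = A *v g (B *v v)" for v
    using ker[of "v - g (B *v v)"] g(2) by (simp add: matrix_vector_mult_diff_distrib)
  moreover have "(A ** ?G ** B) *v v = A *v g (B *v v)" for v
    by (simp add: matrix_vector_mul_assoc[symmetric] matrix_works[OF g(1)])
  ultimately have "A = A ** ?G ** B" unfolding matrix_eq by metis
  hence "transpose A = transpose B ** transpose (A ** ?G)"
    by (metis matrix_transpose_mul)
  moreover have "- B ** C = - (B ** C)" for C :: "'a^'n^'n"
    by (simp add: vec_eq_iff matrix_matrix_mult_def sum_negf)
  ultimately have "A = B ** transpose (A ** ?G)"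
    unfolding assms(1,2) by (metis neg_equal_iff_equal)
  thus ?thesis by blast
qed

definition const_vec :: "'a::zero^'n \<Rightarrow> 'a poly^'n" where
  "const_vec v = (\<chi> i. [:v $ i:])"

lemma sum_linear_poly: "(\<Sum>i\<in>S. [:f i, g i:]) = [:sum f S, sum g S:]"
  by (induction S rule: infinite_finite_induct) auto

lemma pencil_mult_const_vec:
  "pencil A B *v const_vec u = (\<chi> i. [:(A *v u) $ i, (B *v u) $ i:])"
  by (simp add: vec_eq_iff matrix_vector_mult_def pencil_def const_vec_def mult.commute sum_linear_poly)

text \<open>In terms of the eigenvalues of the pencil: the vector \<open>u\<close> lies in the kernel of \<open>A + \<lambda> B\<close> for a
  \<open>\<lambda>\<close> that is finite (then \<open>p\<close> is the corresponding linear factor) or infinite (then \<open>p = 1\<close>), but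
  not in the common kernel of \<open>A\<close> and \<open>B\<close>.\<close>

lemma exists_const_image_direction:
  fixes A B :: "complex^'n^'n"
  assumes "transpose A = - A" "transpose B = - B" "pencil A B \<noteq> 0"
  shows "\<exists>u b p. b \<noteq> 0 \<and> p \<noteq> 0 \<and> pencil A B *v const_vec u = p *s const_vec b"
proof (cases "\<forall>z. B *v z = 0 \<longrightarrow> A *v z = 0")
  case True
  then obtain T where T: "A = B ** T" using skew_factor_through[OF assms(1,2)] by blast
  have "B \<noteq> 0"
  proof
    assume "B = 0"
    moreover from this have "A = 0"
      unfolding T by (simp add: vec_eq_iff matrix_matrix_mult_def)
    ultimately show False using assms(3) by (simp add: pencil_def vec_eq_iff)
  qed
  then obtain y where "B *v y \<noteq> 0" by (metis matrix_eq matrix_vector_mult_0)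
  then obtain z \<mu> where z: "B *v z \<noteq> 0" "B *v (T *v z) = \<mu> *s (B *v z)"
    using exists_relative_eigenvector by blast
  have Az: "A *v z = \<mu> *s (B *v z)"
    using z(2) by (simp add: T matrix_vector_mul_assoc)
  have "pencil A B *v const_vec z = [:\<mu>, 1:] *s const_vec (B *v z)"
    unfolding pencil_mult_const_vec Az by (simp add: vec_eq_iff const_vec_def mult.commute)
  with z(1) show ?thesis by (metis one_neq_zero pCons_eq_0_iff)
next
  case False
  then obtain z where "B *v z = 0" "A *v z \<noteq> 0" by blast
  moreover from this have "pencil A B *v const_vec z = 1 *s const_vec (A *v z)"
    unfolding pencil_mult_const_vec by (simp add: const_vec_def)
  ultimately show ?thesis by (metis one_neq_zero)
qed

section \<open>Splitting off one pair of vectors\<close>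

text \<open>The rank formula over the rational functions, with \<open>u / p\<close> as the preimage of \<open>b\<close>. The inverse is
  harmless: the updated matrix depends only on \<open>b\<close> and \<open>x\<close>, so it stays polynomial.\<close>

lemma normal_rank_skew_update:
  assumes skew: "transpose E = - E" and Eu: "E *v u = p *s b" and "p \<noteq> 0"
    and xb: "scalar_product x b = 1"
  shows "normal_rank E = normal_rank (skew_update E b (E *v x)) + 2"
proof -
  let ?v = "\<lambda>v :: complex poly^'n. (\<chi> i. to_fract (v $ i))"
  let ?M = "\<chi> i j. to_fract (E $ i $ j)"
  let ?u = "inverse (to_fract p) *s ?v u"
  have mv: "?M *v ?v z = ?v (E *v z)" for z
    by (simp add: matrix_vector_mult_def vec_eq_iff)
  have "?M *v ?v u = to_fract p *s ?v b"
    unfolding mv Eu by (simp add: vec_eq_iff)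
  hence Mu: "?M *v ?u = ?v b"
    using \<open>p \<noteq> 0\<close> by (simp add: vector_scalar_commute)
  have "(2 :: complex poly fract) = to_fract 2"
    by (metis one_add_one to_fract_1 to_fract_add)
  hence two: "(2 :: complex poly fract) \<noteq> 0"
    by (metis to_fract_eq_0_iff zero_neq_numeral)
  have skewM: "transpose ?M = - ?M"
    by (rule transpose_eq_uminusI) (subst vec_lambda_beta, subst vec_lambda_beta,
        subst transpose_eq_uminusD[OF skew], simp)
  have "scalar_product (?v x) (?M *v ?u) = to_fract (scalar_product x b)"
    unfolding Mu by (simp add: scalar_product_def)
  hence "scalar_product (?v x) (?M *v ?u) = 1" by (simp add: xb)
  from rank_skew_update[OF skewM two this]
  have "rank ?M = rank (skew_update ?M (?v b) (?v (E *v x))) + 2"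
    unfolding Mu mv .
  moreover have "skew_update ?M (?v b) (?v (E *v x)) =
      (\<chi> i j. to_fract (skew_update E b (E *v x) $ i $ j))"
    by (simp add: skew_update_def vec_eq_iff)
  ultimately show ?thesis by (simp add: normal_rank_def)
qed

lemma normal_rank_eq_0_iff: "normal_rank E = 0 \<longleftrightarrow> E = 0"
proof
  assume "normal_rank E = 0"
  hence "rows (\<chi> i j. to_fract (E $ i $ j)) \<subseteq> {0}"
    by (simp add: normal_rank_def row_rank_def_gen vec.dim_eq_0)
  hence "row i (\<chi> i j. to_fract (E $ i $ j)) = 0" for i
    by (auto simp: rows_def)
  thus "E = 0" by (simp add: row_def vec_eq_iff)
next
  assume "E = 0"
  hence "rows (\<chi> i j. to_fract (E $ i $ j)) \<subseteq> {0}"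
    by (auto simp: rows_def row_def vec_eq_iff)
  thus "normal_rank E = 0"
    by (simp add: normal_rank_def row_rank_def_gen vec.dim_eq_0)
qed

lemma vec_degree_le_iff: "vec_degree v \<le> d \<longleftrightarrow> (\<forall>i. degree (v $ i) \<le> d)"
  by (simp add: vec_degree_def)

text \<open>By induction on the rank: each step removes one pair and lowers the rank by two until the pencil vanishes.\<close>

lemma skew_pencil_decomposition:
  fixes A B :: "complex^'n^'n"
  assumes "transpose A = - A" "transpose B = - B" "normal_rank (pencil A B) = r"
  shows "even r \<and>
    (\<exists>(v :: nat \<Rightarrow> complex poly^'n) w.
      pencil A B =
        (\<Sum>j=1..r div 2. outer_prod (v j) (w j)) - (\<Sum>j=1..r div 2. outer_prod (w j) (v j)) \<and>
      (\<forall>j\<in>{1..r div 2}. vec_degree (v j) = 0) \<and> (\<forall>j\<in>{1..r div 2}. vec_degree (w j) \<le> 1))"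
  using assms
proof (induction r arbitrary: A B rule: less_induct)
  case (less r)
  show ?case
  proof (cases "pencil A B = 0")
    case True
    with less.prems(3) have "r = 0" by (metis normal_rank_eq_0_iff)
    with True show ?thesis by simp
  next
    case False
    let ?E = "pencil A B"
    obtain u b p where ub: "b \<noteq> 0" "p \<noteq> 0" "?E *v const_vec u = p *s const_vec b"
      using exists_const_image_direction[OF less.prems(1,2) False] by blast
    obtain k where "b $ k \<noteq> 0" using ub(1) by (auto simp: vec_eq_iff)
    define x where "x = inverse (b $ k) *s axis k 1"
    have xb: "scalar_product (const_vec x) (const_vec b) = 1"
    proof -
      have "scalar_product (const_vec x) (const_vec b) = (\<Sum>i\<in>UNIV. if i = k then 1 else 0)"
        unfolding scalar_product_def
        by (intro sum.cong refl) (use \<open>b $ k \<noteq> 0\<close> in \<open>auto simp: const_vec_def x_def axis_def one_pCons\<close>)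
      thus ?thesis by simp
    qed
    have skewE: "transpose ?E = - ?E"
    proof (rule transpose_eq_uminusI)
      fix i j
      have "A $ i $ j = - A $ j $ i" "B $ i $ j = - B $ j $ i"
        using less.prems(1,2) by (auto intro: transpose_eq_uminusD)
      thus "?E $ i $ j = - ?E $ j $ i" by (simp add: pencil_def)
    qed
    let ?c = "?E *v const_vec x"
    define A' where "A' = skew_update A b (A *v x)"
    define B' where "B' = skew_update B b (B *v x)"
    have E': "pencil A' B' = skew_update ?E (const_vec b) ?c"
      by (simp add: pencil_mult_const_vec vec_eq_iff)
        (simp add: A'_def B'_def pencil_def skew_update_def const_vec_def mult.commute)
    have r: "r = normal_rank (pencil A' B') + 2"
      using normal_rank_skew_update[OF skewE ub(3,2) xb] less.prems(3) by (simp add: E')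
    have skew': "transpose A' = - A'" "transpose B' = - B'"
      using less.prems(1,2) by (simp_all add: A'_def B'_def transpose_skew_update)
    define s where "s = (r - 2) div 2"
    obtain v w where ev: "even (r - 2)"
      and vw: "pencil A' B' = (\<Sum>j=1..s. outer_prod (v j) (w j)) - (\<Sum>j=1..s. outer_prod (w j) (v j))"
        "\<forall>j\<in>{1..s}. vec_degree (v j) = 0" "\<forall>j\<in>{1..s}. vec_degree (w j) \<le> 1"
    proof -
      have "r - 2 < r" "normal_rank (pencil A' B') = r - 2" using r by linarith+
      from less.IH[OF this(1) skew' this(2)] that show ?thesis
        unfolding s_def by blast
    qed
    have rs: "r div 2 = Suc s" using r by (simp add: s_def)
    let ?v = "v(Suc s := const_vec b)" and ?w = "w(Suc s := - ?c)"
    \<comment> \<open>The update adds \<open>b c\<^sup>T - c b\<^sup>T\<close>, so solving for \<open>?E\<close> gives the pair \<open>(b, - c)\<close>.\<close>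
    have E: "?E = pencil A' B' + outer_prod (const_vec b) (- ?c) - outer_prod (- ?c) (const_vec b)"
      unfolding E' by (simp add: vec_eq_iff skew_update_def outer_prod_def)
    have sums: "(\<Sum>j=1..s. outer_prod (?v j) (?w j)) = (\<Sum>j=1..s. outer_prod (v j) (w j))"
      "(\<Sum>j=1..s. outer_prod (?w j) (?v j)) = (\<Sum>j=1..s. outer_prod (w j) (v j))"
      by (intro sum.cong; simp)+
    have "?E = (\<Sum>j=1..r div 2. outer_prod (?v j) (?w j)) - (\<Sum>j=1..r div 2. outer_prod (?w j) (?v j))"
      by (subst E, subst vw(1)) (simp add: rs sums)
    moreover have "vec_degree (const_vec b) = 0"
      using vec_degree_le_iff[of "const_vec b" 0] by (simp add: const_vec_def)
    hence "\<forall>j\<in>{1..r div 2}. vec_degree (?v j) = 0"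
      using vw(2) by (auto simp: rs)
    moreover have "vec_degree (- ?c) \<le> 1"
      by (simp add: vec_degree_le_iff pencil_mult_const_vec)
    hence "\<forall>j\<in>{1..r div 2}. vec_degree (?w j) \<le> 1"
      using vw(3) by (auto simp: rs)
    moreover have "even r" using ev r by simp
    ultimately show ?thesis by blast
  qed
qed

theorem theorem5:
  fixes A B :: "complex^'n^'n" and r :: nat
  assumes "skew_symmetric_pencil A B"
    and "normal_rank (pencil A B) = r"
    and "r \<le> CARD('n)"
  shows "even r \<and>
    (\<exists>(v :: nat \<Rightarrow> complex poly^'n) (w :: nat \<Rightarrow> complex poly^'n).
      pencil A B =
        (\<Sum>j=1..r div 2. outer_prod (v j) (w j)) - (\<Sum>j=1..r div 2. outer_prod (w j) (v j)) \<and>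
      (\<forall>j\<in>{1..r div 2}. vec_degree (v j) = 0) \<and>
      (\<forall>j\<in>{1..r div 2}. vec_degree (w j) \<le> 1))"
  using skew_pencil_decomposition[of A B r] assms(1,2)
  unfolding skew_symmetric_pencil_def by blast

end
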